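(* Let $f,g$ satisfy Assumptions (A1)–(A4) of the context, let $h(z)=\|\nabla_y g(z)\|^2$, and let $\varepsilon,\alpha_b,w,t_{\max}>0$ and $\beta,\alpha_{\mathrm{ls}},\gamma\in(0,1)$. Suppose $h(z^0)\le\varepsilon^2$, and let $\{z^k\},\{\Delta z^k\},\{t^k\}$ be generated by the algorithm described in the context. Let $L_f$ and $L_h$ be the uniform Lipschitz constants of $\nabla f$ and $\nabla h$ along the bounded sequence $\{z^k\}$, as described in the context. Then the step size $t^k$ chosen by the line search (the Armijo condition together with the safety condition) satisfies $$t^k\ \ge\ t_{\min}=\min\Big\{\beta\,\frac{2(1-\alpha_{\mathrm{ls}})}{L_f},\ \beta\,\frac{\gamma}{\alpha_b},\ \beta\,\frac{2w}{L_h},\ t_{\max}\Big\},\qquad \forall k\ge1.$$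
   Context: Write $z=(x,y)\in\mathbb{R}^{n+m}$; $\|\cdot\|$ is the Euclidean norm; $f,g:\mathbb{R}^n\times\mathbb{R}^m\to\mathbb{R}$. $\nabla_y g(z)\in\mathbb{R}^m$ is the partial gradient in $y$, and $\nabla^2_{yx}g(z)\in\mathbb{R}^{m\times n}$, $\nabla^2_{yy}g(z)\in\mathbb{R}^{m\times m}$ are the Jacobians of $\nabla_y g$ with respect to $x$ and $y$. Assumptions: (A1) $f$ is continuously differentiable, and $\nabla f$ is locally Lipschitz continuous. (A2) $g$ is twice continuously differentiable, and $\nabla^2_{yx}g$, $\nabla^2_{yy}g$ are locally Lipschitz continuous. (A3) For all $z$ with $\nabla_y g(z)\ne0$, $\nabla_y g(z)\notin\mathcal{N}\big([\nabla^2_{yx}g(z)\ \ \nabla^2_{yy}g(z)]^\top\big)$, where $\mathcal{N}$ denotes the null space. (A4) $h$ is coercive: $h(z)\to\infty$ as $\|z\|\to\infty$. Algorithm: start from $z^0$ with $h(z^0)\le\varepsilon^2$; the first pass of the loop, $k=1$, uses the initial point as current iterate ($z^1:=z^0$). For $k=1,2,\dots$: 1. $\Delta z^k$ is the solution of: minimize $\tfrac12\|\Delta z+\nabla f(z^k)\|^2$ over $\Delta z\in\mathbb{R}^{n+m}$ subject to $\nabla h(z^k)^\top\Delta z+\alpha_b(h(z^k)-\varepsilon^2)\le-w\|\Delta z\|^2$. 2. (Backtracking) Set $t=t_{\max}$ and replace $t$ by $\beta t$ until both of the following conditions hold; then $t^k=t$: - Armijo: $f(z^k+t\Delta z^k)\le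 f(z^k)+\alpha_{\mathrm{ls}}\,t\,\nabla f(z^k)^\top\Delta z^k$; - safety: $h(z^k+t\Delta z^k)-\varepsilon^2\le(1-\gamma)(h(z^k)-\varepsilon^2)$. 3. $z^{k+1}=z^k+t^k\Delta z^k$. Lipschitz constants: the safety condition keeps the iterates in the sublevel set $\{h\le\varepsilon^2\}$, so $\{z^k\}$ is bounded by coercivity of $h$; by this boundedness and local Lipschitz continuity, $\nabla f$ and $\nabla h$ are Lipschitz at the iterates $z^k$ with uniform (independent of $k$) constants, denoted $L_f$ and $L_h$ respectively. *)

theory Defs
  imports "HOL-Analysis.Analysis"
begin

text \<open>
  A point $z = (x, y)$ of $R^{n+m}$ is an element of \<^typ>\<open>(real^'n) \<times> (real^'m)\<close>; the norm of the
  product type is the Euclidean norm of the concatenated vector.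
\<close>

definition grad :: "('a::euclidean_space \<Rightarrow> real) \<Rightarrow> 'a \<Rightarrow> 'a" where
  "grad F p = (THE D. GDERIV F p :> D)"

definition grad_y :: "((real^'n) \<times> (real^'m) \<Rightarrow> real) \<Rightarrow> (real^'n) \<times> (real^'m) \<Rightarrow> real^'m" where
  "grad_y g z = grad (\<lambda>y. g (fst z, y)) (snd z)"

definition hess_yx :: "((real^'n) \<times> (real^'m) \<Rightarrow> real) \<Rightarrow> (real^'n) \<times> (real^'m) \<Rightarrow> real^'n^'m" where
  "hess_yx g z = jacobian (\<lambda>x. grad_y g (x, snd z)) (at (fst z))"

definition hess_yy :: "((real^'n) \<times> (real^'m) \<Rightarrow> real) \<Rightarrow> (real^'n) \<times> (real^'m) \<Rightarrow> real^'m^'m" where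
  "hess_yy g z = jacobian (\<lambda>y. grad_y g (fst z, y)) (at (snd z))"

text \<open>The block matrix $[A \; B]$; its columns are indexed by the disjoint sum of the index types.\<close>

definition hcat :: "real^'n^'m \<Rightarrow> real^'k^'m \<Rightarrow> real^('n + 'k)^'m" where
  "hcat A B = (\<chi> i j. case j of Inl a \<Rightarrow> A $ i $ a | Inr b \<Rightarrow> B $ i $ b)"

definition null_space :: "real^'n^'m \<Rightarrow> (real^'n) set" where
  "null_space A = {v. A *v v = 0}"

definition continuously_differentiable ::
    "('a::real_normed_vector \<Rightarrow> 'b::real_normed_vector) \<Rightarrow> bool" where
  "continuously_differentiable F \<longleftrightarrow>
    (\<exists>F' :: 'a \<Rightarrow> 'a \<Rightarrow>\<^sub>L 'b.
      (\<forall>p. (F has_derivative blinfun_apply (F' p)) (at p)) \<and> continuous_on UNIV F')"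

definition twice_continuously_differentiable :: "('a::euclidean_space \<Rightarrow> real) \<Rightarrow> bool" where
  "twice_continuously_differentiable F \<longleftrightarrow>
    continuously_differentiable F \<and> continuously_differentiable (grad F)"

text \<open>The library's \<^const>\<open>local_lipschitz\<close> concerns families of functions with a parameter in a
  metric space; this is the notion for a single function.\<close>

definition locally_lipschitz :: "('a::metric_space \<Rightarrow> 'b::metric_space) \<Rightarrow> bool" where
  "locally_lipschitz F \<longleftrightarrow> (\<forall>p. \<exists>u>0. \<exists>L. L-lipschitz_on (ball p u) F)"

definition solves_subproblem ::
    "('a::euclidean_space \<Rightarrow> real) \<Rightarrow> ('a \<Rightarrow> real) \<Rightarrow> real \<Rightarrow> real \<Rightarrow> real \<Rightarrow> 'a \<Rightarrow> 'a \<Rightarrow> bool" where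
  "solves_subproblem f h \<epsilon> \<alpha>\<^sub>b w z d \<longleftrightarrow>
    is_arg_min (\<lambda>d. 1 / 2 * (norm (d + grad f z))\<^sup>2)
      (\<lambda>d. grad h z \<bullet> d + \<alpha>\<^sub>b * (h z - \<epsilon>\<^sup>2) \<le> - w * (norm d)\<^sup>2) d"

definition armijo ::
    "('a::euclidean_space \<Rightarrow> real) \<Rightarrow> real \<Rightarrow> 'a \<Rightarrow> 'a \<Rightarrow> real \<Rightarrow> bool" where
  "armijo f \<alpha>\<^sub>l\<^sub>s z d t \<longleftrightarrow> f (z + t *\<^sub>R d) \<le> f z + \<alpha>\<^sub>l\<^sub>s * t * (grad f z \<bullet> d)"

definition safety ::
    "('a::euclidean_space \<Rightarrow> real) \<Rightarrow> real \<Rightarrow> real \<Rightarrow> 'a \<Rightarrow> 'a \<Rightarrow> real \<Rightarrow> bool" where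
  "safety h \<epsilon> \<gamma> z d t \<longleftrightarrow> h (z + t *\<^sub>R d) - \<epsilon>\<^sup>2 \<le> (1 - \<gamma>) * (h z - \<epsilon>\<^sup>2)"

text \<open>
  The first acceptable step among $t_{max}, \beta t_{max}, \beta^2 t_{max}, \ldots$.  If no trial
  step is acceptable the value is unspecified; termination of the search is not built in.
\<close>

definition backtrack :: "real \<Rightarrow> real \<Rightarrow> (real \<Rightarrow> bool) \<Rightarrow> real" where
  "backtrack t\<^sub>m\<^sub>a\<^sub>x \<beta> accept = t\<^sub>m\<^sub>a\<^sub>x * \<beta> ^ (LEAST j::nat. accept (t\<^sub>m\<^sub>a\<^sub>x * \<beta> ^ j))"

text \<open>
  \<open>L\<close> is a Lipschitz constant of \<open>F\<close> at each of the iterates $z^k$, uniformly in $k \ge 1$, where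
  the points compared with $z^k$ range over the region \<open>S\<close> containing the iterates.  This is implied
  by \<open>L-lipschitz_on S F\<close>.
\<close>

definition lipschitz_at_iterates ::
    "real \<Rightarrow> 'a set \<Rightarrow> (nat \<Rightarrow> 'a) \<Rightarrow> ('a::metric_space \<Rightarrow> 'b::metric_space) \<Rightarrow> bool" where
  "lipschitz_at_iterates L S z F \<longleftrightarrow>
    (\<forall>k\<ge>1. \<forall>p\<in>S. dist (F p) (F (z k)) \<le> L * dist p (z k))"

end

theory Submission
  imports Defs
begin

text \<open>
  Write \<open>d\<close> for the direction at the iterate \<open>z\<close>.  The sublevel set \<open>{h \<le> \<epsilon>\<^sup>2}\<close> need not be convex,
  so before the descent lemma can be used on \<open>[z, z + s d]\<close> one has to know that this segment
  stays in it.  As long as it does, the descent lemma and the constraint of the subproblem give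
  \<open>h (z + s d) - \<epsilon>\<^sup>2 \<le> (1 - \<alpha>\<^sub>b s) (h z - \<epsilon>\<^sup>2) - s (w - L\<^sub>h s / 2) \<parallel>d\<parallel>\<^sup>2\<close>, which for \<open>d \<noteq> 0\<close> is strictly
  negative when \<open>0 < s < min (1 / \<alpha>\<^sub>b) (2 w / L\<^sub>h)\<close>; by continuity the segment cannot leave before that bound.  The
  same estimate yields the safety condition when \<open>s \<le> \<gamma> / \<alpha>\<^sub>b\<close>.  Comparing \<open>d\<close> with its feasible multiples \<open>\<theta> d\<close>,
  \<open>0 \<le> \<theta> \<le> 1\<close>, gives \<open>\<nabla>f(z) \<bullet> d \<le> - \<parallel>d\<parallel>\<^sup>2\<close>, and then the descent lemma for \<open>f\<close> yields the Armijo
  condition when \<open>s \<le> 2 (1 - \<alpha>\<^sub>l\<^sub>s) / L\<^sub>f\<close>.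
\<close>

section \<open>Gradients and differentiability\<close>

lemma GDERIV_unique:
  assumes "GDERIV F p :> D" "GDERIV F p :> E"
  shows "D = E"
proof -
  have "(\<lambda>v. v \<bullet> D) = (\<lambda>v. v \<bullet> E)"
    using assms unfolding gderiv_def by (rule has_derivative_unique)
  then have "\<forall>v. v \<bullet> D = v \<bullet> E" by (rule fun_cong [THEN allI])
  then show ?thesis
    by (simp add: vector_eq_ldot)
qed

lemma grad_eqI: "GDERIV F p :> D \<Longrightarrow> grad F p = D"
  unfolding grad_def by (blast intro: GDERIV_unique)

lemma GDERIV_grad:
  fixes F :: "'a::euclidean_space \<Rightarrow> real"
  assumes "F differentiable (at p)"
  shows "GDERIV F p :> grad F p"
proof -
  from assms obtain F' where F': "(F has_derivative F') (at p)"
    by (auto simp: differentiable_def)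
  then have "F' = (\<lambda>v. v \<bullet> adjoint F' 1)"
    using adjoint_works[OF has_derivative_linear] by fastforce
  then have "GDERIV F p :> adjoint F' 1"
    using F' unfolding gderiv_def by simp
  then show ?thesis
    by (metis grad_eqI)
qed

lemma continuously_differentiable_imp_differentiable:
  "continuously_differentiable F \<Longrightarrow> F differentiable (at p)"
  unfolding continuously_differentiable_def differentiable_def by blast

lemma grad_y_eq_snd_grad:
  assumes "g differentiable (at p)"
  shows "grad_y g p = snd (grad g p)"
proof -
  have *: "((\<lambda>y. (fst p, y)) has_derivative (\<lambda>v. (0, v))) (at (snd p))"
    by (auto intro!: derivative_eq_intros)
  have "(g has_derivative (\<lambda>v. v \<bullet> grad g p)) (at (fst p, snd p))"
    using GDERIV_grad[OF assms] unfolding gderiv_def by simp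
  from has_derivative_compose[OF * this]
  have "GDERIV (\<lambda>y. g (fst p, y)) (snd p) :> snd (grad g p)"
    unfolding gderiv_def by (simp add: inner_prod_def)
  then show ?thesis
    unfolding grad_y_def by (rule grad_eqI)
qed

text \<open>The partial gradient is the second block of \<open>grad g\<close>, which is itself
  differentiable, so the square is an inner product of differentiable maps. This makes
  \<open>h\<close> differentiable everywhere.\<close>

lemma differentiable_norm_grad_y_squared:
  assumes "twice_continuously_differentiable g"
  shows "(\<lambda>p. (norm (grad_y g p))\<^sup>2) differentiable (at p)"
proof -
  have C: "g differentiable (at q)" "grad g differentiable (at q)" for q
    using assms continuously_differentiable_imp_differentiable
    unfolding twice_continuously_differentiable_def by blast+
  obtain D where "(grad g has_derivative D) (at p)"
    using C(2) unfolding differentiable_def by blast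
  then have "((\<lambda>p. snd (grad g p) \<bullet> snd (grad g p)) has_derivative
      (\<lambda>v. snd (grad g p) \<bullet> snd (D v) + snd (D v) \<bullet> snd (grad g p))) (at p)"
    by (intro derivative_intros)
  moreover have "(\<lambda>p. (norm (grad_y g p))\<^sup>2) = (\<lambda>p. snd (grad g p) \<bullet> snd (grad g p))"
    using grad_y_eq_snd_grad[OF C(1)] by (simp add: power2_norm_eq_inner)
  ultimately show ?thesis
    by (auto simp: differentiable_def)
qed

section \<open>Descent and continuation along a segment\<close>

lemma DERIV_along_line:
  fixes F :: "'a::euclidean_space \<Rightarrow> real"
  assumes "\<And>p. F differentiable (at p)"
  shows "((\<lambda>s. F (z + s *\<^sub>R d)) has_real_derivative grad F (z + s *\<^sub>R d) \<bullet> d) (at s)"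
proof -
  have *: "((\<lambda>s. z + s *\<^sub>R d) has_derivative (\<lambda>v. v *\<^sub>R d)) (at s)"
    by (auto intro!: derivative_eq_intros)
  have "(\<lambda>v. (v *\<^sub>R d) \<bullet> grad F (z + s *\<^sub>R d)) = (*) (grad F (z + s *\<^sub>R d) \<bullet> d)"
    by (auto simp: inner_commute)
  with has_derivative_compose[OF * GDERIV_grad[OF assms, unfolded gderiv_def]]
  show ?thesis
    unfolding has_field_derivative_def by simp
qed

text \<open>The Lipschitz bound is required only between \<open>z\<close> and points of the segment,
  so the lemma applies on a nonconvex region as soon as the segment lies in it.\<close>

lemma descent_along_segment:
  fixes F :: "'a::euclidean_space \<Rightarrow> real"
  assumes diff: "\<And>p. F differentiable (at p)" and "0 \<le> s"
    and lip: "\<And>r. 0 \<le> r \<Longrightarrow> r \<le> s \<Longrightarrow>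
      dist (grad F (z + r *\<^sub>R d)) (grad F z) \<le> L * dist (z + r *\<^sub>R d) z"
  shows "F (z + s *\<^sub>R d) \<le> F z + s * (grad F z \<bullet> d) + L * s\<^sup>2 / 2 * (norm d)\<^sup>2"
proof -
  \<comment> \<open>The gap between \<open>F\<close> and its quadratic model. By Cauchy-Schwarz and
    \<open>lip\<close> its derivative is nonpositive.\<close>
  let ?\<psi> = "\<lambda>r. F (z + r *\<^sub>R d) - r * (grad F z \<bullet> d) - L * r\<^sup>2 / 2 * (norm d)\<^sup>2"
  have "?\<psi> s \<le> ?\<psi> 0"
  proof (rule DERIV_nonpos_imp_nonincreasing[OF \<open>0 \<le> s\<close>])
    fix r assume r: "0 \<le> r" "r \<le> s"
    let ?D = "grad F (z + r *\<^sub>R d) \<bullet> d - grad F z \<bullet> d - L * r * (norm d)\<^sup>2"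
    have "(?\<psi> has_real_derivative ?D) (at r)"
      by (auto intro!: derivative_eq_intros DERIV_along_line[OF diff])
    moreover have "(grad F (z + r *\<^sub>R d) - grad F z) \<bullet> d
        \<le> norm (grad F (z + r *\<^sub>R d) - grad F z) * norm d"
      by (rule norm_cauchy_schwarz)
    moreover have "\<dots> \<le> L * (r * norm d) * norm d"
      using lip[OF r] r by (intro mult_right_mono) (auto simp: dist_norm)
    ultimately show "\<exists>y. (?\<psi> has_real_derivative y) (at r) \<and> y \<le> 0"
      by (intro exI[of _ ?D]) (auto simp: inner_diff_left power2_eq_square mult.assoc)
  qed
  then show ?thesis by simp
qed

text \<open>The first exit time leads to a contradiction: by continuity the bound still holds at the
  infimum of the bad times, and \<open>extend\<close> then carries it past that infimum.\<close>

lemma stays_below_by_continuation: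
  fixes \<phi> :: "real \<Rightarrow> real"
  assumes cont: "continuous_on {0..T} \<phi>" and start: "\<phi> 0 \<le> c"
    and extend: "\<And>\<tau>. 0 \<le> \<tau> \<Longrightarrow> \<tau> < T \<Longrightarrow> \<forall>r\<in>{0..\<tau>}. \<phi> r \<le> c \<Longrightarrow>
      \<exists>\<delta>>0. \<forall>r\<in>{\<tau><..<\<tau> + \<delta>}. \<phi> r \<le> c"
    and s: "0 \<le> s" "s \<le> T"
  shows "\<phi> s \<le> c"
proof (rule ccontr)
  assume "\<not> \<phi> s \<le> c"
  define B where "B = {r\<in>{0..s}. \<phi> r > c}"
  define \<tau> where "\<tau> = Inf B"
  have "s \<in> B" and bdd: "bdd_below B"
    using s \<open>\<not> \<phi> s \<le> c\<close> by (auto simp: B_def)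
  then have \<tau>: "0 \<le> \<tau>" "\<tau> \<le> s"
    unfolding \<tau>_def by (auto simp: B_def intro!: cInf_greatest cInf_lower)
  have before: "\<phi> r \<le> c" if "0 \<le> r" "r < \<tau>" for r
    using that \<tau> cInf_lower[OF _ bdd, of r] by (force simp: \<tau>_def B_def)
  have "\<phi> \<tau> \<le> c"
  proof (cases "\<tau> = 0")
    case False
    then have "continuous_on (closure {0..<\<tau>}) \<phi>"
      using \<tau> s by (auto intro!: continuous_on_subset[OF cont])
    moreover have "\<tau> \<in> closure {0..<\<tau>}"
      using False \<tau> by simp
    ultimately show ?thesis
      by (rule continuous_le_on_closure) (use before in auto)
  qed (use start in simp)
  then have upto: "\<forall>r\<in>{0..\<tau>}. \<phi> r \<le> c"
    using before by (metis atLeastAtMost_iff order_le_less)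
  then have "\<tau> \<noteq> s"
    using \<tau> \<open>\<not> \<phi> s \<le> c\<close> by auto
  with extend[OF _ _ upto] \<tau> s obtain \<delta>
    where "\<delta> > 0" and \<delta>: "\<forall>r\<in>{\<tau><..<\<tau> + \<delta>}. \<phi> r \<le> c" by auto
  have "\<tau> + \<delta> \<le> Inf B"
  proof (rule cInf_greatest)
    fix r assume "r \<in> B"
    then have "\<not> r \<le> \<tau>" "r \<notin> {\<tau><..<\<tau> + \<delta>}"
      using upto \<delta> by (force simp: B_def)+
    then show "\<tau> + \<delta> \<le> r" by auto
  qed (use \<open>s \<in> B\<close> in auto)
  with \<open>\<delta> > 0\<close> show False by (simp add: \<tau>_def)
qed

section \<open>The subproblem and the sublevel set\<close>

lemma solves_subproblem_descent:
  assumes sol: "solves_subproblem f h \<epsilon> \<alpha>\<^sub>b w z d"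
    and "h z \<le> \<epsilon>\<^sup>2" "\<alpha>\<^sub>b > 0" "w > 0"
  shows "grad f z \<bullet> d \<le> - (norm d)\<^sup>2"
proof -
  let ?g = "grad f z"
  have feas: "grad h z \<bullet> d + \<alpha>\<^sub>b * (h z - \<epsilon>\<^sup>2) \<le> - w * (norm d)\<^sup>2"
    and opt: "\<And>v. grad h z \<bullet> v + \<alpha>\<^sub>b * (h z - \<epsilon>\<^sup>2) \<le> - w * (norm v)\<^sup>2 \<Longrightarrow>
      (norm (d + ?g))\<^sup>2 \<le> (norm (v + ?g))\<^sup>2"
    using sol unfolding solves_subproblem_def is_arg_min_linorder by auto
  have *: "2 * (d \<bullet> (d + ?g)) \<le> \<eta> * (norm d)\<^sup>2" if "0 < \<eta>" "\<eta> < 1" for \<eta>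
  proof -
    let ?\<theta> = "1 - \<eta>"
    have "\<eta> * (\<alpha>\<^sub>b * (h z - \<epsilon>\<^sup>2)) \<le> 0" "0 \<le> w * (norm d)\<^sup>2 * (?\<theta> * \<eta>)"
      using assms that by (auto simp: mult_nonneg_nonpos)
    moreover have "?\<theta> * (grad h z \<bullet> d + \<alpha>\<^sub>b * (h z - \<epsilon>\<^sup>2)) \<le> ?\<theta> * (- w * (norm d)\<^sup>2)"
      using feas that by (intro mult_left_mono) auto
    \<comment> \<open>Feasibility of the shrunken direction: its constraint excess is
      \<open>?\<theta>\<close> times that of \<open>d\<close>, plus two nonpositive terms. The last
      one arises from \<open>?\<theta>\<^sup>2 = ?\<theta> - ?\<theta> * \<eta>\<close>.\<close>
    moreover have "grad h z \<bullet> (?\<theta> *\<^sub>R d) + \<alpha>\<^sub>b * (h z - \<epsilon>\<^sup>2) + w * (norm (?\<theta> *\<^sub>R d))\<^sup>2 =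
        ?\<theta> * (grad h z \<bullet> d + \<alpha>\<^sub>b * (h z - \<epsilon>\<^sup>2)) - ?\<theta> * (- w * (norm d)\<^sup>2)
        + \<eta> * (\<alpha>\<^sub>b * (h z - \<epsilon>\<^sup>2)) - w * (norm d)\<^sup>2 * (?\<theta> * \<eta>)"
      by (simp add: power_mult_distrib) (simp add: algebra_simps power2_eq_square)
    ultimately have "grad h z \<bullet> (?\<theta> *\<^sub>R d) + \<alpha>\<^sub>b * (h z - \<epsilon>\<^sup>2) \<le> - w * (norm (?\<theta> *\<^sub>R d))\<^sup>2"
      by linarith
    from opt[OF this] have "(d + ?g) \<bullet> (d + ?g) \<le> (?\<theta> *\<^sub>R d + ?g) \<bullet> (?\<theta> *\<^sub>R d + ?g)"
      by (simp add: power2_norm_eq_inner)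
    moreover have "?\<theta> *\<^sub>R d + ?g = (d + ?g) - \<eta> *\<^sub>R d"
      by (simp add: algebra_simps)
    ultimately have "\<eta> * (2 * (d \<bullet> (d + ?g))) \<le> \<eta> * (\<eta> * (d \<bullet> d))"
      by (simp only: inner_diff_left inner_diff_right) (simp add: inner_commute algebra_simps)
    then show ?thesis
      using that by (simp add: power2_norm_eq_inner)
  qed
  \<comment> \<open>Letting \<open>\<eta>\<close> tend to 0 from the right yields the first-order
    optimality condition along the ray.\<close>
  have "2 * (d \<bullet> (d + ?g)) \<le> 0"
  proof -
    have "((\<lambda>\<eta>. \<eta> * (norm d)\<^sup>2) \<longlongrightarrow> 0) (at_right 0)"
      by (auto intro!: tendsto_eq_intros)
    moreover have "\<forall>\<^sub>F \<eta> in at_right 0. 2 * (d \<bullet> (d + ?g)) \<le> \<eta> * (norm d)\<^sup>2"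
      using * by (auto simp: eventually_at_right[of 0 1] intro!: exI[of _ 1])
    ultimately show ?thesis
      by (intro tendsto_lowerbound) auto
  qed
  then show ?thesis
    by (simp add: inner_add_right power2_norm_eq_inner inner_commute)
qed

lemma segment_in_sublevel:
  fixes h :: "'a::euclidean_space \<Rightarrow> real"
  assumes diff: "\<And>p. h differentiable (at p)" and below: "h z \<le> c"
    and feas: "grad h z \<bullet> d + \<alpha>\<^sub>b * (h z - c) \<le> - w * (norm d)\<^sup>2"
    and pos: "\<alpha>\<^sub>b > 0" "w > 0" "L > 0"
    and lip: "\<And>p. h p \<le> c \<Longrightarrow> dist (grad h p) (grad h z) \<le> L * dist p z"
    and s: "0 \<le> s" "s \<le> 1 / \<alpha>\<^sub>b" "s \<le> 2 * w / L"
  shows "h (z + s *\<^sub>R d) \<le> c"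
    and "h (z + s *\<^sub>R d) - c \<le> (1 - \<alpha>\<^sub>b * s) * (h z - c)"
proof -
  let ?\<phi> = "\<lambda>s. h (z + s *\<^sub>R d)"
  note DERIV = DERIV_along_line[OF diff, of z d]
  have cont: "isCont ?\<phi> r" for r
    using DERIV by (rule DERIV_isCont)
  \<comment> \<open>Conditional on the segment up to \<open>\<tau>\<close> lying in the sublevel
    set, because \<open>lip\<close> is available only there.\<close>
  have est: "?\<phi> \<tau> - c \<le> (1 - \<alpha>\<^sub>b * \<tau>) * (h z - c) - \<tau> * (w - L * \<tau> / 2) * (norm d)\<^sup>2"
    if "0 \<le> \<tau>" and "\<forall>r\<in>{0..\<tau>}. ?\<phi> r \<le> c" for \<tau>
  proof -
    have "?\<phi> \<tau> \<le> h z + \<tau> * (grad h z \<bullet> d) + L * \<tau>\<^sup>2 / 2 * (norm d)\<^sup>2"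
      using that lip by (intro descent_along_segment[OF diff]) auto
    with mult_left_mono[OF feas \<open>0 \<le> \<tau>\<close>] show ?thesis
      by (simp add: algebra_simps power2_eq_square)
  qed
  have stay: "?\<phi> r \<le> c" if "0 \<le> r" "r \<le> s" for r
  proof (rule stays_below_by_continuation[where \<phi> = ?\<phi> and T = s])
    show "continuous_on {0..s} ?\<phi>"
      using cont by (simp add: continuous_at_imp_continuous_on)
    fix \<tau> assume \<tau>: "0 \<le> \<tau>" "\<tau> < s" and upto: "\<forall>r\<in>{0..\<tau>}. ?\<phi> r \<le> c"
    show "\<exists>\<delta>>0. \<forall>r\<in>{\<tau><..<\<tau> + \<delta>}. ?\<phi> r \<le> c"
    proof (cases "?\<phi> \<tau> < c")
      case True
      then have "\<forall>\<^sub>F r in at \<tau>. ?\<phi> r < c"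
        using cont[of \<tau>] by (auto simp: isCont_def intro: order_tendstoD)
      then obtain \<delta> where "\<delta> > 0" "\<forall>r. r \<noteq> \<tau> \<and> dist r \<tau> < \<delta> \<longrightarrow> ?\<phi> r < c"
        by (auto simp: eventually_at)
      then show ?thesis
        by (intro exI[of _ \<delta>]) (force simp: dist_real_def)
    next
      \<comment> \<open>Here \<open>\<tau>\<close> sits on the boundary of the sublevel set. Since
        \<open>\<tau> < s\<close>, both step bounds are strict at \<open>\<tau>\<close>, so for
        \<open>d \<noteq> 0\<close> and \<open>\<tau> > 0\<close> the estimate \<open>est\<close>
        excludes this case.\<close>
      case False
      have "\<tau> < 1 / \<alpha>\<^sub>b" "\<tau> < 2 * w / L"
        using \<tau> s by linarith+
      then have *: "\<alpha>\<^sub>b * \<tau> < 1" "L * \<tau> < 2 * w"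
        using pos by (simp_all add: field_simps)
      consider "d = 0" | "d \<noteq> 0" "\<tau> = 0" | "d \<noteq> 0" "\<tau> > 0"
        using \<tau> by fastforce
      then show ?thesis
      proof cases
        case 1
        then show ?thesis using below by (auto intro: exI[of _ 1])
      next
        case 2
        \<comment> \<open>At \<open>\<tau> = 0\<close> the estimate gives no strict decrease;
          instead the constraint, active at the boundary, makes \<open>d\<close> a strict descent
          direction of \<open>h\<close>.\<close>
        with False below have "h z = c" by simp
        with feas have "grad h z \<bullet> d \<le> - w * (norm d)\<^sup>2" by simp
        also have "\<dots> < 0" using 2 pos by simp
        finally have "grad h (z + 0 *\<^sub>R d) \<bullet> d < 0" by simp
        from DERIV_neg_dec_right[OF DERIV this] obtain \<delta>
          where "\<delta> > 0" "\<forall>r>0. r < \<delta> \<longrightarrow> ?\<phi> (0 + r) < ?\<phi> 0" by auto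
        with \<open>h z = c\<close> 2 show ?thesis
          by (intro exI[of _ \<delta>]) force
      next
        case 3
        then have "0 < \<tau> * (w - L * \<tau> / 2) * (norm d)\<^sup>2"
          using * by simp
        moreover have "(1 - \<alpha>\<^sub>b * \<tau>) * (h z - c) \<le> 0"
          using * below by (simp add: mult_nonneg_nonpos)
        ultimately have "?\<phi> \<tau> < c"
          using est[OF \<tau>(1) upto] by linarith
        with False show ?thesis by simp
      qed
    qed
  qed (use below that in auto)
  show "?\<phi> s \<le> c"
    using stay s by simp
  have "0 \<le> s * (w - L * s / 2) * (norm d)\<^sup>2"
    using s pos by (intro mult_nonneg_nonneg) (auto simp: field_simps)
  with est[of s] stay s show "?\<phi> s - c \<le> (1 - \<alpha>\<^sub>b * s) * (h z - c)"
    by fastforce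
qed

section \<open>Backtracking and acceptance of short steps\<close>

text \<open>The trial steps tend to 0 and so eventually fall below \<open>T\<close>. Hence the
  search terminates and its \<open>LEAST\<close> exponent is meaningful.\<close>

lemma backtrack_accepted:
  assumes "\<And>s. 0 < s \<Longrightarrow> s \<le> T \<Longrightarrow> accept s"
    and "T > 0" "t\<^sub>m\<^sub>a\<^sub>x > 0" "0 < \<beta>" "\<beta> < 1"
  shows "accept (backtrack t\<^sub>m\<^sub>a\<^sub>x \<beta> accept)"
proof -
  obtain j where "\<beta> ^ j < T / t\<^sub>m\<^sub>a\<^sub>x"
    using real_arch_pow_inv[of "T / t\<^sub>m\<^sub>a\<^sub>x" \<beta>] assms by auto
  then have "accept (t\<^sub>m\<^sub>a\<^sub>x * \<beta> ^ j)"
    using assms by (intro assms(1)) (auto simp: field_simps)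
  then show ?thesis
    unfolding backtrack_def by (rule LeastI)
qed

lemma backtrack_ge:
  assumes acc: "\<And>s. 0 < s \<Longrightarrow> s \<le> T \<Longrightarrow> accept s"
    and "t\<^sub>m\<^sub>a\<^sub>x > 0" "0 < \<beta>"
  shows "min (\<beta> * T) t\<^sub>m\<^sub>a\<^sub>x \<le> backtrack t\<^sub>m\<^sub>a\<^sub>x \<beta> accept"
proof (cases "LEAST j::nat. accept (t\<^sub>m\<^sub>a\<^sub>x * \<beta> ^ j)")
  case 0
  then show ?thesis by (simp add: backtrack_def)
next
  \<comment> \<open>The trial with exponent \<open>i\<close> was the last one rejected, so it
    exceeds \<open>T\<close>; the accepted step is \<open>\<beta>\<close> times it.\<close>
  case (Suc i)
  then have "\<not> accept (t\<^sub>m\<^sub>a\<^sub>x * \<beta> ^ i)"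
    using not_less_Least[of i "\<lambda>j. accept (t\<^sub>m\<^sub>a\<^sub>x * \<beta> ^ j)"] by simp
  then have "T < t\<^sub>m\<^sub>a\<^sub>x * \<beta> ^ i"
    using acc[of "t\<^sub>m\<^sub>a\<^sub>x * \<beta> ^ i"] assms by force
  then have "\<beta> * T \<le> \<beta> * (t\<^sub>m\<^sub>a\<^sub>x * \<beta> ^ i)"
    using \<open>0 < \<beta>\<close> by simp
  with Suc show ?thesis
    by (simp add: backtrack_def mult.left_commute min.coboundedI1)
qed

lemma small_steps_accepted:
  fixes f h :: "'a::euclidean_space \<Rightarrow> real"
  assumes diff: "\<And>p. f differentiable (at p)" "\<And>p. h differentiable (at p)"
    and below: "h z \<le> \<epsilon>\<^sup>2"
    and sol: "solves_subproblem f h \<epsilon> \<alpha>\<^sub>b w z d"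
    and pos: "\<alpha>\<^sub>b > 0" "w > 0" "L\<^sub>f > 0" "L\<^sub>h > 0" "\<gamma> < 1"
    and lip: "\<And>p. h p \<le> \<epsilon>\<^sup>2 \<Longrightarrow> dist (grad f p) (grad f z) \<le> L\<^sub>f * dist p z"
      "\<And>p. h p \<le> \<epsilon>\<^sup>2 \<Longrightarrow> dist (grad h p) (grad h z) \<le> L\<^sub>h * dist p z"
    and s: "0 < s" "s \<le> 2 * (1 - \<alpha>\<^sub>l\<^sub>s) / L\<^sub>f" "s \<le> \<gamma> / \<alpha>\<^sub>b" "s \<le> 2 * w / L\<^sub>h"
  shows "armijo f \<alpha>\<^sub>l\<^sub>s z d s" "safety h \<epsilon> \<gamma> z d s"
proof -
  have feas: "grad h z \<bullet> d + \<alpha>\<^sub>b * (h z - \<epsilon>\<^sup>2) \<le> - w * (norm d)\<^sup>2"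
    using sol by (simp add: solves_subproblem_def is_arg_min_def)
  \<comment> \<open>Since \<open>\<gamma> < 1\<close>, the safety threshold lies within the range
    where the segment is known to stay in the sublevel set.\<close>
  have "\<gamma> / \<alpha>\<^sub>b \<le> 1 / \<alpha>\<^sub>b"
    using pos by (simp add: divide_right_mono)
  then have s': "s \<le> 1 / \<alpha>\<^sub>b"
    using s by linarith
  note seg = segment_in_sublevel[OF diff(2) below feas pos(1,2,4) lip(2)]
  \<comment> \<open>The factor \<open>h z - \<epsilon>\<^sup>2\<close> is nonpositive, so the larger
    coefficient gives the smaller product.\<close>
  have "(1 - \<alpha>\<^sub>b * s) * (h z - \<epsilon>\<^sup>2) \<le> (1 - \<gamma>) * (h z - \<epsilon>\<^sup>2)"
    using s pos below by (intro mult_right_mono_neg) (auto simp: field_simps)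
  with seg(2)[of s] s s' show "safety h \<epsilon> \<gamma> z d s"
    by (simp add: safety_def)
  have "f (z + s *\<^sub>R d) \<le> f z + s * (grad f z \<bullet> d) + L\<^sub>f * s\<^sup>2 / 2 * (norm d)\<^sup>2"
    using s s' by (intro descent_along_segment[OF diff(1)] lip(1) seg(1)) auto
  also have "\<dots> \<le> f z + \<alpha>\<^sub>l\<^sub>s * s * (grad f z \<bullet> d)"
  proof -
    have gd: "grad f z \<bullet> d \<le> - (norm d)\<^sup>2"
      using solves_subproblem_descent[OF sol below pos(1,2)] .
    have "L\<^sub>f * s / 2 * (norm d)\<^sup>2 \<le> (1 - \<alpha>\<^sub>l\<^sub>s) * (norm d)\<^sup>2"
      using s pos by (intro mult_right_mono) (auto simp: field_simps)
    also have "\<dots> \<le> (1 - \<alpha>\<^sub>l\<^sub>s) * - (grad f z \<bullet> d)"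
    proof (rule mult_left_mono)
      \<comment> \<open>The sign is recovered from the existence of a positive \<open>s\<close>
        below this bound.\<close>
      have "0 < 2 * (1 - \<alpha>\<^sub>l\<^sub>s) / L\<^sub>f" using s by linarith
      then show "0 \<le> 1 - \<alpha>\<^sub>l\<^sub>s" using pos by (simp add: zero_less_divide_iff)
    qed (use gd in simp)
    finally have "s * (L\<^sub>f * s / 2 * (norm d)\<^sup>2) \<le> s * ((1 - \<alpha>\<^sub>l\<^sub>s) * - (grad f z \<bullet> d))"
      using s by (intro mult_left_mono) auto
    then show ?thesis
      by (simp add: algebra_simps power2_eq_square)
  qed
  finally show "armijo f \<alpha>\<^sub>l\<^sub>s z d s"
    by (simp add: armijo_def)
qed

theorem lemma1:
  fixes f g h :: "(real^'n) \<times> (real^'m) \<Rightarrow> real"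
    and z \<Delta>z :: "nat \<Rightarrow> (real^'n) \<times> (real^'m)"
    and t :: "nat \<Rightarrow> real"
    and \<epsilon> \<alpha>\<^sub>b w t\<^sub>m\<^sub>a\<^sub>x \<beta> \<alpha>\<^sub>l\<^sub>s \<gamma> L\<^sub>f L\<^sub>h :: real
  assumes h_eq: "\<And>p. h p = (norm (grad_y g p))\<^sup>2"
    and A1: "continuously_differentiable f" "locally_lipschitz (grad f)"
    and A2: "twice_continuously_differentiable g"
      "locally_lipschitz (hess_yx g)" "locally_lipschitz (hess_yy g)"
    and A3: "\<And>p. grad_y g p \<noteq> 0 \<Longrightarrow>
      grad_y g p \<notin> null_space (transpose (hcat (hess_yx g p) (hess_yy g p)))"
    and A4: "filterlim h at_top at_infinity"
    and parameters: "\<epsilon> > 0" "\<alpha>\<^sub>b > 0" "w > 0" "t\<^sub>m\<^sub>a\<^sub>x > 0"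
      "0 < \<beta>" "\<beta> < 1" "0 < \<alpha>\<^sub>l\<^sub>s" "\<alpha>\<^sub>l\<^sub>s < 1" "0 < \<gamma>" "\<gamma> < 1"
    and initial: "h (z 0) \<le> \<epsilon>\<^sup>2" "z 1 = z 0"
    and direction: "\<And>k. k \<ge> 1 \<Longrightarrow> solves_subproblem f h \<epsilon> \<alpha>\<^sub>b w (z k) (\<Delta>z k)"
    and line_search: "\<And>k. k \<ge> 1 \<Longrightarrow> t k = backtrack t\<^sub>m\<^sub>a\<^sub>x \<beta>
      (\<lambda>s. armijo f \<alpha>\<^sub>l\<^sub>s (z k) (\<Delta>z k) s \<and> safety h \<epsilon> \<gamma> (z k) (\<Delta>z k) s)"
    and update: "\<And>k. k \<ge> 1 \<Longrightarrow> z (Suc k) = z k + t k *\<^sub>R \<Delta>z k"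
    and lipschitz: "L\<^sub>f > 0" "lipschitz_at_iterates L\<^sub>f {p. h p \<le> \<epsilon>\<^sup>2} z (grad f)"
      "L\<^sub>h > 0" "lipschitz_at_iterates L\<^sub>h {p. h p \<le> \<epsilon>\<^sup>2} z (grad h)"
  shows "\<forall>k\<ge>1. t k \<ge>
    Min {\<beta> * (2 * (1 - \<alpha>\<^sub>l\<^sub>s) / L\<^sub>f), \<beta> * (\<gamma> / \<alpha>\<^sub>b), \<beta> * (2 * w / L\<^sub>h), t\<^sub>m\<^sub>a\<^sub>x}"
proof -
  \<comment> \<open>The bound on acceptable steps before the factor \<open>\<beta>\<close>, which is
    lost to one backtracking reduction.\<close>
  define T where "T = Min {2 * (1 - \<alpha>\<^sub>l\<^sub>s) / L\<^sub>f, \<gamma> / \<alpha>\<^sub>b, 2 * w / L\<^sub>h}"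
  have "T > 0"
    using parameters lipschitz by (simp add: T_def)
  have "f differentiable (at p)" "h differentiable (at p)" for p
    using continuously_differentiable_imp_differentiable[OF A1(1)]
      differentiable_norm_grad_y_squared[OF A2(1)] by (simp_all add: h_eq[abs_def])
  note diff = this
  let ?accept = "\<lambda>k s. armijo f \<alpha>\<^sub>l\<^sub>s (z k) (\<Delta>z k) s \<and> safety h \<epsilon> \<gamma> (z k) (\<Delta>z k) s"
  have accept: "?accept k s"
    if "k \<ge> 1" "h (z k) \<le> \<epsilon>\<^sup>2" "0 < s" "s \<le> T" for k s
    using small_steps_accepted[OF diff that(2) direction[OF that(1)], of L\<^sub>f L\<^sub>h \<gamma> s \<alpha>\<^sub>l\<^sub>s]
      that parameters lipschitz
    by (auto simp: lipschitz_at_iterates_def T_def)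
  \<comment> \<open>Membership in the sublevel set and termination of the search go hand in hand:
    the former makes short steps acceptable at \<open>z k\<close>, and the safety condition of the
    accepted step passes it on to \<open>z (Suc k)\<close>.\<close>
  have below: "h (z k) \<le> \<epsilon>\<^sup>2" if "k \<ge> 1" for k
    using that
  proof (induction k rule: dec_induct)
    case base
    then show ?case using initial by simp
  next
    case (step k)
    have "safety h \<epsilon> \<gamma> (z k) (\<Delta>z k) (t k)"
      using backtrack_accepted[of T "?accept k" t\<^sub>m\<^sub>a\<^sub>x \<beta>,
          OF accept[OF step.hyps(1) step.IH] \<open>T > 0\<close>] parameters
        line_search[OF step.hyps(1)] by simp
    then have "h (z (Suc k)) - \<epsilon>\<^sup>2 \<le> (1 - \<gamma>) * (h (z k) - \<epsilon>\<^sup>2)"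
      using update[OF step.hyps(1)] by (simp add: safety_def)
    also have "\<dots> \<le> 0"
      using step.IH parameters by (simp add: mult_nonneg_nonpos)
    finally show ?case by simp
  qed
  have "min (\<beta> * T) t\<^sub>m\<^sub>a\<^sub>x \<le> t k" if "k \<ge> 1" for k
    using backtrack_ge[of T "?accept k" t\<^sub>m\<^sub>a\<^sub>x \<beta>, OF accept[OF that below[OF that]]]
      parameters line_search[OF that] by simp
  then show ?thesis
    using parameters by (simp add: T_def min_mult_distrib_left min.assoc)
qed

end
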